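(* Let $f$ and $\mathcal{F}$ satisfy Assumptions A and B of the context, and let $\epsilon_g,\epsilon_H>0$. The number of iterations required for the Second Order Frank–Wolfe algorithm described in the context, applied to $\min_{\mathbf{x}\in\mathcal{F}}f(\mathbf{x})$, to find an $\epsilon_g$-first order stationary point is at most $\mathcal{O}(\epsilon_g^{-2})$. Moreover, the number of iterations required to find an $(\epsilon_g,\epsilon_H)$-second order stationary point is at most $\mathcal{O}\left(\max\{\epsilon_g^{-2},\epsilon_H^{-3}\}\right)$.
   Context: Problem: $\min_{\mathbf{x}\in\mathcal{F}}f(\mathbf{x})$, $f:\mathbb{R}^n\to\mathbb{R}$; norms are Euclidean (spectral for matrices). Stationarity measures: for $\mathbf{x}\in\mathcal{F}$, $$\mathcal{X}(\mathbf{x})=-\min_{\mathbf{s}}\{\langle\nabla f(\mathbf{x}),\mathbf{s}\rangle:\mathbf{x}+\mathbf{s}\in\mathcal{F},\|\mathbf{s}\|\le1\},$$ $$\psi(\mathbf{x},\alpha)=-\min_{\mathbf{d}}\{\mathbf{d}^T\nabla^2f(\mathbf{x})\mathbf{d}:\mathbf{x}+\mathbf{d}\in\mathcal{F},\|\mathbf{d}\|\le1,\langle\nabla f(\mathbf{x}),\mathbf{d}\rangle\le\alpha\}.$$ Write $\mathcal{X}_k=\mathcal{X}(\mathbf{x}_k)$ and $\psi_{k,\alpha}=\psi(\mathbf{x}_k,\alpha)$. A point $\bar{\mathbf{x}}\in\mathcal{F}$ is an $\epsilon_g$-first order stationary point if $\mathcal{X}(\bar{\mathbf{x}})\le\epsilon_g$,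 and an $(\epsilon_g,\epsilon_H)$-second order stationary point if $\mathcal{X}(\bar{\mathbf{x}})\le\epsilon_g$ and $\psi(\bar{\mathbf{x}},0)\le\epsilon_H$. Assumption A: $f$ is twice continuously differentiable and bounded below by a scalar $f_{min}$ on $\mathcal{F}$; $\mathcal{F}$ is closed and convex; $\nabla f$ and $\nabla^2f$ are Lipschitz continuous with constants $L$ and $\rho$, respectively; there are constants $g_{max},H_{max}>0$ with $\|\nabla f(\mathbf{x}_k)\|_2\le g_{max}$ and $\|\nabla^2f(\mathbf{x}_k)\|_2\le H_{max}$ for all iterates $\mathbf{x}_k$. Assumption B: there is a constant $\beta>0$ such that every $\mathbf{x}\in\mathcal{F}$ with $\mathcal{X}(\mathbf{x})=0$ satisfies either $\psi(\mathbf{x},0)=0$ or $\psi(\mathbf{x},0)\ge\beta$. Algorithm (Second Order Frank–Wolfe with Fixed Step-size). Inputs: $\mathbf{x}_0\in\mathcal{F}$, $\widetilde L=\max\{L,g_{max}\}$, $\widetilde\rho=\max\{\rho,2H_{max}\}$, $\gamma>1$, $\alpha_0\in(0,1]$. For $k=0,1,2,\dots$: start with $\alpha_k$ equal to the input value $\alpha_0$. Compute $\mathcal{X}_k$ with a minimizer $\widehat{\mathbf{s}}_k$ of the problem defining $\mathcal{X}(\mathbf{x}_k)$, and $\psi_{k,\alpha_k}$ with a minimizer $\widehat{\mathbf{d}}_k$ of the problem defining $\psi(\mathbf{x}_k,\alpha_k)$. If $\psi_{k,\alpha_k}=\mathcal{X}_k=0$, terminate and return $\mathbf{x}_k$. Otherwise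 loop: (1) if $\frac{\mathcal{X}_k^2}{2\widetilde L}\ge\frac{\psi_{k,\alpha_k}^3}{3\widetilde\rho^2}$, set $\mathbf{x}_{k+1}=\mathbf{x}_k+\frac{\mathcal{X}_k}{\widetilde L}\widehat{\mathbf{s}}_k$ and exit the loop; (2) else, if $f(\mathbf{x}_k)-f\big(\mathbf{x}_k+\frac{2\psi_{k,\alpha_k}}{\widetilde\rho}\widehat{\mathbf{d}}_k\big)\ge\frac{\psi_{k,\alpha_k}^3}{3\widetilde\rho^2}$, $\ \widetilde\rho\ge2\psi_{k,\alpha_k}$ and $\langle\nabla f(\mathbf{x}_k),\widehat{\mathbf{d}}_k\rangle\le\frac{\psi_{k,\alpha_k}^2}{6\widetilde\rho}$ all hold, set $\mathbf{x}_{k+1}=\mathbf{x}_k+\frac{2\psi_{k,\alpha_k}}{\widetilde\rho}\widehat{\mathbf{d}}_k$ and exit the loop; (3) else replace $\alpha_k$ by $\alpha_k/\gamma$, recompute $\widehat{\mathbf{d}}_k,\psi_{k,\alpha_k}$ and return to (1). An iteration is one value of the index $k$; the algorithm finds a point with a given property at the first $k$ for which $\mathbf{x}_k$ has it. The constants hidden in $\mathcal{O}(\cdot)$ do not depend on $\epsilon_g,\epsilon_H$ (they may depend on $f(\mathbf{x}_0)-f_{min}$ and on the other problem and algorithm constants). *)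

theory Defs
  imports "HOL-Analysis.Analysis" "HOL-Library.While_Combinator"
begin

definition grad :: "(real ^ 'n \<Rightarrow> real) \<Rightarrow> real ^ 'n \<Rightarrow> real ^ 'n" where
  "grad f x = (THE D. GDERIV f x :> D)"

definition hess :: "(real ^ 'n \<Rightarrow> real) \<Rightarrow> real ^ 'n \<Rightarrow> real ^ 'n ^ 'n" where
  "hess f x = matrix (frechet_derivative (grad f) (at x))"

definition twice_cont_diff :: "(real ^ 'n \<Rightarrow> real) \<Rightarrow> bool" where
  "twice_cont_diff f \<longleftrightarrow>
     (\<forall>x. f differentiable at x) \<and> (\<forall>x. grad f differentiable at x) \<and>
     continuous_on UNIV (hess f)"

text \<open>The library norm on matrices is the Frobenius norm, so the spectral norm is
  written as an operator norm.\<close>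
definition spectral_norm :: "real ^ 'n ^ 'n \<Rightarrow> real" where
  "spectral_norm A = onorm ((*v) A)"

definition dirs1 :: "(real ^ 'n) set \<Rightarrow> real ^ 'n \<Rightarrow> (real ^ 'n) set" where
  "dirs1 F x = {s. x + s \<in> F \<and> norm s \<le> 1}"

definition dirs2 ::
  "(real ^ 'n \<Rightarrow> real) \<Rightarrow> (real ^ 'n) set \<Rightarrow> real ^ 'n \<Rightarrow> real \<Rightarrow> (real ^ 'n) set" where
  "dirs2 f F x \<alpha> = {d. x + d \<in> F \<and> norm d \<le> 1 \<and> grad f x \<bullet> d \<le> \<alpha>}"

text \<open>\<open>LEAST\<close> over the attained values is the minimum; it exists for \<open>F\<close> closed,
  \<open>x \<in> F\<close> and \<open>\<alpha> \<ge> 0\<close>, the feasible sets then being compact and containing \<open>0\<close>.\<close>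
definition chi :: "(real ^ 'n \<Rightarrow> real) \<Rightarrow> (real ^ 'n) set \<Rightarrow> real ^ 'n \<Rightarrow> real" where
  "chi f F x = - (LEAST v. v \<in> (\<lambda>s. grad f x \<bullet> s) ` dirs1 F x)"

definition psi :: "(real ^ 'n \<Rightarrow> real) \<Rightarrow> (real ^ 'n) set \<Rightarrow> real ^ 'n \<Rightarrow> real \<Rightarrow> real" where
  "psi f F x \<alpha> = - (LEAST v. v \<in> (\<lambda>d. d \<bullet> (hess f x *v d)) ` dirs2 f F x \<alpha>)"

definition first_order_stationary ::
  "(real ^ 'n \<Rightarrow> real) \<Rightarrow> (real ^ 'n) set \<Rightarrow> real \<Rightarrow> real ^ 'n \<Rightarrow> bool" where
  "first_order_stationary f F \<epsilon>g x \<longleftrightarrow> x \<in> F \<and> chi f F x \<le> \<epsilon>g"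

definition second_order_stationary ::
  "(real ^ 'n \<Rightarrow> real) \<Rightarrow> (real ^ 'n) set \<Rightarrow> real \<Rightarrow> real \<Rightarrow> real ^ 'n \<Rightarrow> bool" where
  "second_order_stationary f F \<epsilon>g \<epsilon>H x \<longleftrightarrow>
     x \<in> F \<and> chi f F x \<le> \<epsilon>g \<and> psi f F x 0 \<le> \<epsilon>H"

text \<open>The subproblem solvers: \<open>S k x\<close> and \<open>D k x \<alpha>\<close> are the minimizers used in iteration
  \<open>k\<close> if the current iterate is \<open>x\<close>. Which minimizer is returned is left arbitrary.\<close>
definition minimizer_choice ::
  "(real ^ 'n \<Rightarrow> real) \<Rightarrow> (real ^ 'n) set \<Rightarrow> (nat \<Rightarrow> real ^ 'n \<Rightarrow> real ^ 'n)
   \<Rightarrow> (nat \<Rightarrow> real ^ 'n \<Rightarrow> real \<Rightarrow> real ^ 'n) \<Rightarrow> bool" where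
  "minimizer_choice f F S D \<longleftrightarrow>
     (\<forall>k. \<forall>x\<in>F. is_arg_min (\<lambda>s. grad f x \<bullet> s) (\<lambda>s. s \<in> dirs1 F x) (S k x)) \<and>
     (\<forall>k. \<forall>x\<in>F. \<forall>\<alpha>>0.
        is_arg_min (\<lambda>d. d \<bullet> (hess f x *v d)) (\<lambda>d. d \<in> dirs2 f F x \<alpha>) (D k x \<alpha>))"

definition first_order_test ::
  "(real ^ 'n \<Rightarrow> real) \<Rightarrow> (real ^ 'n) set \<Rightarrow> real \<Rightarrow> real \<Rightarrow> real ^ 'n \<Rightarrow> real \<Rightarrow> bool" where
  "first_order_test f F Lt \<rho>t x \<alpha> \<longleftrightarrow>
     (chi f F x)\<^sup>2 / (2 * Lt) \<ge> psi f F x \<alpha> ^ 3 / (3 * \<rho>t\<^sup>2)"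

definition second_order_test ::
  "(real ^ 'n \<Rightarrow> real) \<Rightarrow> (real ^ 'n) set \<Rightarrow> real \<Rightarrow> real ^ 'n \<Rightarrow> real \<Rightarrow> real ^ 'n \<Rightarrow> bool" where
  "second_order_test f F \<rho>t x \<alpha> d \<longleftrightarrow>
     f x - f (x + (2 * psi f F x \<alpha> / \<rho>t) *\<^sub>R d) \<ge> psi f F x \<alpha> ^ 3 / (3 * \<rho>t\<^sup>2) \<and>
     \<rho>t \<ge> 2 * psi f F x \<alpha> \<and>
     grad f x \<bullet> d \<le> (psi f F x \<alpha>)\<^sup>2 / (6 * \<rho>t)"

text \<open>One iteration. \<open>None\<close> means that there is no next iterate, either because the algorithm
  terminates at \<open>x\<close> or because its inner loop runs forever; in the latter case
  \<open>while_option\<close> returns \<open>None\<close>.\<close>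
definition sofw_step ::
  "(real ^ 'n \<Rightarrow> real) \<Rightarrow> (real ^ 'n) set \<Rightarrow> real \<Rightarrow> real \<Rightarrow> real \<Rightarrow> real
   \<Rightarrow> (real ^ 'n \<Rightarrow> real ^ 'n) \<Rightarrow> (real ^ 'n \<Rightarrow> real \<Rightarrow> real ^ 'n)
   \<Rightarrow> real ^ 'n \<Rightarrow> (real ^ 'n) option" where
  "sofw_step f F Lt \<rho>t \<gamma> \<alpha>0 s d x =
     (if psi f F x \<alpha>0 = 0 \<and> chi f F x = 0 then None
      else case while_option
             (\<lambda>\<alpha>. \<not> first_order_test f F Lt \<rho>t x \<alpha> \<and> \<not> second_order_test f F \<rho>t x \<alpha> (d x \<alpha>))
             (\<lambda>\<alpha>. \<alpha> / \<gamma>) \<alpha>0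
           of None \<Rightarrow> None
            | Some \<alpha> \<Rightarrow>
                Some (if first_order_test f F Lt \<rho>t x \<alpha>
                      then x + (chi f F x / Lt) *\<^sub>R s x
                      else x + (2 * psi f F x \<alpha> / \<rho>t) *\<^sub>R d x \<alpha>))"

primrec sofw_iterate ::
  "(real ^ 'n \<Rightarrow> real) \<Rightarrow> (real ^ 'n) set \<Rightarrow> real \<Rightarrow> real \<Rightarrow> real \<Rightarrow> real
   \<Rightarrow> (nat \<Rightarrow> real ^ 'n \<Rightarrow> real ^ 'n) \<Rightarrow> (nat \<Rightarrow> real ^ 'n \<Rightarrow> real \<Rightarrow> real ^ 'n)
   \<Rightarrow> real ^ 'n \<Rightarrow> nat \<Rightarrow> (real ^ 'n) option" where
  "sofw_iterate f F Lt \<rho>t \<gamma> \<alpha>0 S D x0 0 = Some x0"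
| "sofw_iterate f F Lt \<rho>t \<gamma> \<alpha>0 S D x0 (Suc k) =
     Option.bind (sofw_iterate f F Lt \<rho>t \<gamma> \<alpha>0 S D x0 k)
       (sofw_step f F Lt \<rho>t \<gamma> \<alpha>0 (S k) (D k))"

text \<open>\<open>X k = None\<close> means that the \<open>k\<close>-th iterate does not exist.\<close>
definition first_found_at ::
  "(nat \<Rightarrow> (real ^ 'n) option) \<Rightarrow> (real ^ 'n \<Rightarrow> bool) \<Rightarrow> nat \<Rightarrow> bool" where
  "first_found_at X P k \<longleftrightarrow>
     (\<exists>x. X k = Some x \<and> P x) \<and> (\<forall>j<k. \<not> (\<exists>x. X j = Some x \<and> P x))"

text \<open>The Lipschitz conditions are only imposed on \<open>F\<close>, which is implied by Lipschitz
  continuity on the whole space.\<close>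
definition assumption_A ::
  "(real ^ 'n \<Rightarrow> real) \<Rightarrow> (real ^ 'n) set \<Rightarrow> real \<Rightarrow> real \<Rightarrow> real \<Rightarrow> real \<Rightarrow> real
   \<Rightarrow> (nat \<Rightarrow> (real ^ 'n) option) \<Rightarrow> bool" where
  "assumption_A f F fmin L \<rho> gmax Hmax X \<longleftrightarrow>
     twice_cont_diff f \<and> (\<forall>x\<in>F. fmin \<le> f x) \<and> closed F \<and> convex F \<and>
     L-lipschitz_on F (grad f) \<and>
     0 \<le> \<rho> \<and> (\<forall>x\<in>F. \<forall>y\<in>F. spectral_norm (hess f x - hess f y) \<le> \<rho> * dist x y) \<and>
     gmax > 0 \<and> Hmax > 0 \<and>
     (\<forall>k x. X k = Some x \<longrightarrow> norm (grad f x) \<le> gmax \<and> spectral_norm (hess f x) \<le> Hmax)"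

definition assumption_B ::
  "(real ^ 'n \<Rightarrow> real) \<Rightarrow> (real ^ 'n) set \<Rightarrow> real \<Rightarrow> bool" where
  "assumption_B f F \<beta> \<longleftrightarrow>
     \<beta> > 0 \<and> (\<forall>x\<in>F. chi f F x = 0 \<longrightarrow> psi f F x 0 = 0 \<or> psi f F x 0 \<ge> \<beta>)"

end

theory Submission
  imports Defs
begin

text \<open>
  Every iteration from a point that is not yet stationary decreases \<open>f\<close> by a fixed amount, and the
  total decrease is at most \<open>f x0 - fmin\<close>; counting the iterations gives both bounds.

  Write \<open>\<chi>\<close> for \<open>chi f F x\<close>, \<open>Lt\<close> for \<open>max L gmax\<close> and \<open>\<rho>t\<close> for \<open>max \<rho> (2 * Hmax)\<close>.  A first-order
  step of length \<open>\<chi> / Lt\<close> decreases \<open>f\<close> by at least \<open>\<chi>\<^sup>2 / (2 * Lt)\<close>, because the gradient is Lipschitz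
  continuous (\<open>first_order_decrease\<close>), and a second-order step decreases \<open>f\<close> by at least
  \<open>psi f F x \<alpha> ^ 3 / (3 * \<rho>t\<^sup>2)\<close>, because the acceptance test demands it.  The first-order test
  compares exactly these two quantities, so whichever step is taken achieves the larger of them.
  Moreover \<open>psi f F x 0 \<le> psi f F x \<alpha>\<close>, so the decrease is bounded below independently of the \<open>\<alpha>\<close>
  at which the inner loop stops (\<open>step_decrease\<close>).

  The inner loop could run forever only if \<open>\<alpha>\<close> tends to \<open>0\<close>.  If \<open>psi f F x \<alpha>\<close> stays away from \<open>0\<close>,
  then eventually \<open>grad f x \<bullet> d \<le> \<alpha>\<close> is small compared with its square, and the Lipschitz continuity
  of the Hessian makes the second-order step acceptable (\<open>second_order_test_holds\<close>).  The value
  \<open>psi f F x \<alpha>\<close> does stay away from \<open>0\<close> if \<open>\<chi> > 0\<close>, because the first-order test fails, and if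
  \<open>psi f F x 0 > 0\<close>, by monotonicity.
  In the remaining case \<open>\<chi> = psi f F x 0 = 0\<close> the loop may indeed run forever, but then \<open>x\<close> is
  stationary for all tolerances, so the point sought has been found (\<open>step_exists\<close>).
\<close>

section \<open>Derivatives along lines\<close>

lemma GDERIV_grad:
  fixes f :: "real ^ 'n \<Rightarrow> real"
  assumes "f differentiable at x"
  shows "GDERIV f x :> grad f x"
proof -
  obtain f' where f': "(f has_derivative f') (at x)"
    using assms by (auto simp: differentiable_def)
  have "linear f'"
    using f' by (rule has_derivative_linear)
  then have "f' = (\<lambda>h. h \<bullet> adjoint f' 1)"
    by (intro ext) (simp add: adjoint_works)
  then have ex: "GDERIV f x :> adjoint f' 1"
    unfolding gderiv_def by (rule has_derivative_eq_rhs[OF f'])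
  have unique: "D = E" if "GDERIV f x :> D" "GDERIV f x :> E" for D E
  proof -
    have "(\<lambda>h. h \<bullet> D) = (\<lambda>h. h \<bullet> E)"
      using that unfolding gderiv_def by (rule has_derivative_unique)
    then show ?thesis
      using vector_eq_ldot[of D E] by (simp add: fun_eq_iff)
  qed
  show ?thesis
    unfolding grad_def using ex unique[OF _ ex] by (rule theI)
qed

lemma grad_has_derivative_hess:
  fixes f :: "real ^ 'n \<Rightarrow> real"
  assumes "grad f differentiable at x"
  shows "(grad f has_derivative (\<lambda>h. hess f x *v h)) (at x)"
proof -
  have der: "(grad f has_derivative frechet_derivative (grad f) (at x)) (at x)"
    using assms by (simp add: frechet_derivative_works)
  then have "linear (frechet_derivative (grad f) (at x))"
    by (rule has_derivative_linear)
  then have "(\<lambda>h. hess f x *v h) = frechet_derivative (grad f) (at x)"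
    unfolding hess_def by simp
  with der show ?thesis by metis
qed

lemma DERIV_along_line:
  fixes f :: "real ^ 'n \<Rightarrow> real"
  assumes "twice_cont_diff f"
  shows "((\<lambda>u. f (x + u *\<^sub>R d)) has_real_derivative grad f (x + u *\<^sub>R d) \<bullet> d) (at u)"
proof -
  have "(f has_derivative (\<lambda>h. h \<bullet> grad f (x + u *\<^sub>R d))) (at (x + u *\<^sub>R d))"
    using GDERIV_grad assms unfolding gderiv_def twice_cont_diff_def by blast
  moreover have "((\<lambda>u. x + u *\<^sub>R d) has_derivative (\<lambda>v. v *\<^sub>R d)) (at u)"
    by (auto intro!: derivative_eq_intros)
  ultimately have "((\<lambda>u. f (x + u *\<^sub>R d)) has_derivative
      (\<lambda>v. (v *\<^sub>R d) \<bullet> grad f (x + u *\<^sub>R d))) (at u)"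
    by (intro has_derivative_compose[where f = "\<lambda>u. x + u *\<^sub>R d" and g = "f"
          and f' = "\<lambda>v. v *\<^sub>R d"])
  moreover have "(\<lambda>v. (v *\<^sub>R d) \<bullet> grad f (x + u *\<^sub>R d)) = (*) (grad f (x + u *\<^sub>R d) \<bullet> d)"
    by (rule ext) (metis inner_commute inner_scaleR_left mult.commute)
  ultimately show ?thesis
    unfolding has_field_derivative_def by (rule has_derivative_eq_rhs)
qed

lemma DERIV_slope_along_line:
  fixes f :: "real ^ 'n \<Rightarrow> real"
  assumes "twice_cont_diff f"
  shows "((\<lambda>u. grad f (x + u *\<^sub>R d) \<bullet> d) has_real_derivative
      d \<bullet> (hess f (x + u *\<^sub>R d) *v d)) (at u)"
proof -
  have "(grad f has_derivative (\<lambda>h. hess f (x + u *\<^sub>R d) *v h)) (at (x + u *\<^sub>R d))"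
    using grad_has_derivative_hess assms unfolding twice_cont_diff_def by blast
  moreover have "((\<lambda>u. x + u *\<^sub>R d) has_derivative (\<lambda>v. v *\<^sub>R d)) (at u)"
    by (auto intro!: derivative_eq_intros)
  ultimately have "((\<lambda>u. grad f (x + u *\<^sub>R d)) has_derivative
      (\<lambda>v. hess f (x + u *\<^sub>R d) *v (v *\<^sub>R d))) (at u)"
    by (intro has_derivative_compose[where f = "\<lambda>u. x + u *\<^sub>R d" and g = "grad f"
          and f' = "\<lambda>v. v *\<^sub>R d"])
  then have "((\<lambda>u. grad f (x + u *\<^sub>R d) \<bullet> d) has_derivative
      (\<lambda>v. (hess f (x + u *\<^sub>R d) *v (v *\<^sub>R d)) \<bullet> d)) (at u)"
    by (rule has_derivative_inner_left)
  moreover have "(\<lambda>v. (hess f (x + u *\<^sub>R d) *v (v *\<^sub>R d)) \<bullet> d) =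
      (*) (d \<bullet> (hess f (x + u *\<^sub>R d) *v d))"
    by (rule ext) (metis inner_commute inner_scaleR_left mult.commute matrix_vector_mult_scaleR)
  ultimately show ?thesis
    unfolding has_field_derivative_def by (rule has_derivative_eq_rhs)
qed

lemma increment_le_of_DERIV_le:
  fixes g h :: "real \<Rightarrow> real"
  assumes "0 \<le> t"
    and g: "\<And>u. (g has_real_derivative g' u) (at u)"
    and h: "\<And>u. (h has_real_derivative h' u) (at u)"
    and le: "\<And>u. 0 \<le> u \<Longrightarrow> u \<le> t \<Longrightarrow> g' u \<le> h' u"
  shows "g t - g 0 \<le> h t - h 0"
proof -
  have "((\<lambda>u. g u - h u) has_real_derivative g' u - h' u) (at u)" for u
    using g h by (rule DERIV_diff)
  then have "g t - h t \<le> g 0 - h 0"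
    using DERIV_nonpos_imp_nonincreasing[of 0 t "\<lambda>u. g u - h u"] assms(1) le
    by (metis diff_le_0_iff_le)
  then show ?thesis by simp
qed

lemma quadratic_form_le_spectral_norm:
  fixes A :: "real ^ 'n ^ 'n"
  assumes "norm d \<le> 1"
  shows "\<bar>d \<bullet> (A *v d)\<bar> \<le> spectral_norm A"
proof -
  have "norm (A *v d) \<le> spectral_norm A * norm d"
    unfolding spectral_norm_def by (rule onorm) (rule matrix_vector_mul_bounded_linear)
  moreover have "0 \<le> spectral_norm A"
    unfolding spectral_norm_def by (rule onorm_pos_le) (rule matrix_vector_mul_bounded_linear)
  ultimately have "norm (A *v d) \<le> spectral_norm A"
    using assms by (meson mult_left_le order_trans)
  have "\<bar>d \<bullet> (A *v d)\<bar> \<le> norm d * norm (A *v d)"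
    by (rule Cauchy_Schwarz_ineq2)
  also have "\<dots> \<le> 1 * spectral_norm A"
    using assms \<open>norm (A *v d) \<le> spectral_norm A\<close> by (intro mult_mono) auto
  finally show ?thesis by simp
qed

section \<open>The stationarity measures\<close>

lemma Least_image_eq_arg_min:
  fixes g :: "'a \<Rightarrow> real"
  assumes "is_arg_min g (\<lambda>s. s \<in> A) m"
  shows "(LEAST v. v \<in> g ` A) = g m"
  using assms by (intro Least_equality) (auto simp: is_arg_min_linorder)

text \<open>The constraint \<open>grad f x \<bullet> d \<le> \<alpha>\<close> with \<open>\<alpha> \<ge> 0\<close> keeps \<open>d = 0\<close> feasible, so the minimum is
  attained by compactness.  The subproblem solver is available only for \<open>\<alpha> > 0\<close>, while the
  stationarity condition concerns \<open>\<alpha> = 0\<close>.\<close>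
lemma psi_attained:
  fixes f :: "real ^ 'n \<Rightarrow> real"
  assumes "closed F" "x \<in> F" "0 \<le> \<alpha>"
  obtains d where "is_arg_min (\<lambda>d. d \<bullet> (hess f x *v d)) (\<lambda>d. d \<in> dirs2 f F x \<alpha>) d"
proof -
  have "dirs2 f F x \<alpha> = (\<lambda>d. x + d) -` F \<inter> (cball 0 1 \<inter> {d. grad f x \<bullet> d \<le> \<alpha>})"
    by (auto simp: dirs2_def)
  moreover have "closed ((\<lambda>d. x + d) -` F)"
    using assms(1) by (intro closed_vimage continuous_intros)
  moreover have "compact (cball 0 1 \<inter> {d. grad f x \<bullet> d \<le> \<alpha>})"
    by (intro compact_Int_closed compact_cball closed_halfspace_le)
  ultimately have "compact (dirs2 f F x \<alpha>)"
    by (metis closed_Int_compact)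
  moreover have "0 \<in> dirs2 f F x \<alpha>"
    using assms by (simp add: dirs2_def)
  moreover have "continuous_on (dirs2 f F x \<alpha>) (\<lambda>d. d \<bullet> (hess f x *v d))"
    by (intro continuous_intros linear_continuous_on matrix_vector_mul_bounded_linear)
  ultimately show thesis
    using continuous_attains_inf[of "dirs2 f F x \<alpha>" "\<lambda>d. d \<bullet> (hess f x *v d)"] that
    by (auto simp: is_arg_min_linorder)
qed

lemma psi_eq:
  assumes "is_arg_min (\<lambda>d. d \<bullet> (hess f x *v d)) (\<lambda>d. d \<in> dirs2 f F x \<alpha>) d"
  shows "psi f F x \<alpha> = - (d \<bullet> (hess f x *v d))"
  unfolding psi_def using Least_image_eq_arg_min[OF assms] by simp

lemma chi_eq:
  assumes "is_arg_min (\<lambda>s. grad f x \<bullet> s) (\<lambda>s. s \<in> dirs1 F x) s"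
  shows "chi f F x = - (grad f x \<bullet> s)"
  unfolding chi_def using Least_image_eq_arg_min[OF assms] by simp

lemma chi_nonneg:
  assumes "x \<in> F" "is_arg_min (\<lambda>s. grad f x \<bullet> s) (\<lambda>s. s \<in> dirs1 F x) s"
  shows "0 \<le> chi f F x"
proof -
  have "grad f x \<bullet> s \<le> grad f x \<bullet> 0"
    using assms unfolding is_arg_min_linorder by (simp add: dirs1_def del: inner_zero_right)
  then show ?thesis using chi_eq[OF assms(2)] by simp
qed

lemma chi_le_norm_grad:
  assumes "is_arg_min (\<lambda>s. grad f x \<bullet> s) (\<lambda>s. s \<in> dirs1 F x) s"
  shows "chi f F x \<le> norm (grad f x)"
proof -
  have "norm s \<le> 1"
    using assms by (simp add: is_arg_min_linorder dirs1_def)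
  have "chi f F x \<le> \<bar>grad f x \<bullet> s\<bar>"
    using chi_eq[OF assms] by simp
  also have "\<dots> \<le> norm (grad f x) * norm s"
    by (rule Cauchy_Schwarz_ineq2)
  also have "\<dots> \<le> norm (grad f x)"
    using \<open>norm s \<le> 1\<close> by (simp add: mult_left_le)
  finally show ?thesis .
qed

lemma psi_le_spectral_norm:
  assumes "closed F" "x \<in> F" "0 \<le> \<alpha>"
  shows "psi f F x \<alpha> \<le> spectral_norm (hess f x)"
proof -
  obtain d where d: "is_arg_min (\<lambda>d. d \<bullet> (hess f x *v d)) (\<lambda>d. d \<in> dirs2 f F x \<alpha>) d"
    using psi_attained[OF assms] .
  then have "norm d \<le> 1"
    by (simp add: is_arg_min_linorder dirs2_def)
  then show ?thesis
    using quadratic_form_le_spectral_norm[of d "hess f x"] psi_eq[OF d] by simp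
qed

lemma psi_mono:
  assumes "closed F" "x \<in> F" "0 \<le> \<alpha>" "\<alpha> \<le> \<alpha>'"
  shows "psi f F x \<alpha> \<le> psi f F x \<alpha>'"
proof -
  obtain d where d: "is_arg_min (\<lambda>d. d \<bullet> (hess f x *v d)) (\<lambda>d. d \<in> dirs2 f F x \<alpha>) d"
    using psi_attained[OF assms(1-3)] .
  obtain d' where d': "is_arg_min (\<lambda>d. d \<bullet> (hess f x *v d)) (\<lambda>d. d \<in> dirs2 f F x \<alpha>') d'"
    using psi_attained[of F x \<alpha>'] assms by auto
  have "d \<in> dirs2 f F x \<alpha>'"
    using d assms(4) by (auto simp: is_arg_min_linorder dirs2_def)
  then show ?thesis
    using psi_eq[OF d] psi_eq[OF d'] d' by (simp add: is_arg_min_linorder)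
qed

lemma psi_nonneg:
  assumes "closed F" "x \<in> F" "0 \<le> \<alpha>"
  shows "0 \<le> psi f F x \<alpha>"
proof -
  obtain d where d: "is_arg_min (\<lambda>d. d \<bullet> (hess f x *v d)) (\<lambda>d. d \<in> dirs2 f F x \<alpha>) d"
    using psi_attained[OF assms] .
  have "0 \<in> dirs2 f F x \<alpha>"
    using assms by (simp add: dirs2_def)
  then have "d \<bullet> (hess f x *v d) \<le> 0 \<bullet> (hess f x *v 0)"
    using d unfolding is_arg_min_linorder by blast
  then show ?thesis using psi_eq[OF d] by simp
qed

section \<open>Decrease achieved by a step\<close>

locale smooth_on_convex =
  fixes f :: "real ^ 'n \<Rightarrow> real" and F :: "(real ^ 'n) set" and L \<rho> :: real
  assumes smooth: "twice_cont_diff f"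
    and closed: "closed F"
    and convex: "convex F"
    and grad_lipschitz: "L-lipschitz_on F (grad f)"
    and \<rho>_nonneg: "0 \<le> \<rho>"
    and hess_lipschitz:
      "\<And>x y. x \<in> F \<Longrightarrow> y \<in> F \<Longrightarrow> spectral_norm (hess f x - hess f y) \<le> \<rho> * dist x y"
begin

lemma segment_in:
  assumes "x \<in> F" "x + d \<in> F" "0 \<le> u" "u \<le> 1"
  shows "x + u *\<^sub>R d \<in> F"
proof -
  have "(1 - u) *\<^sub>R x + u *\<^sub>R (x + d) \<in> F"
    using convexD_alt[OF convex] assms by blast
  then show ?thesis by (simp add: algebra_simps)
qed

lemma quadratic_upper_bound:
  assumes "x \<in> F" "x + s \<in> F" "norm s \<le> 1" "0 \<le> t" "t \<le> 1"
  shows "f (x + t *\<^sub>R s) \<le> f x + t * (grad f x \<bullet> s) + L * t\<^sup>2 / 2"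
proof -
  have "0 \<le> L"
    using grad_lipschitz by (rule lipschitz_on_nonneg)
  have slope: "grad f (x + u *\<^sub>R s) \<bullet> s \<le> grad f x \<bullet> s + L * u" if "0 \<le> u" "u \<le> t" for u
  proof -
    have "norm (grad f (x + u *\<^sub>R s) - grad f x) \<le> L * norm (u *\<^sub>R s)"
      using lipschitz_onD[OF grad_lipschitz segment_in[OF assms(1,2)] assms(1), of u] that assms
      by (simp add: dist_norm)
    also have "\<dots> \<le> L * u"
      using \<open>0 \<le> L\<close> that assms(3) by (simp add: mult_left_le mult_left_mono)
    finally have b: "norm (grad f (x + u *\<^sub>R s) - grad f x) \<le> L * u" .
    have "(grad f (x + u *\<^sub>R s) - grad f x) \<bullet> s \<le> norm (grad f (x + u *\<^sub>R s) - grad f x) * norm s"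
      by (rule norm_cauchy_schwarz)
    also have "\<dots> \<le> norm (grad f (x + u *\<^sub>R s) - grad f x)"
      using assms(3) by (simp add: mult_left_le)
    finally show ?thesis
      using b by (simp add: inner_diff_left)
  qed
  have bound: "((\<lambda>u. u * (grad f x \<bullet> s) + L * u\<^sup>2 / 2) has_real_derivative
      grad f x \<bullet> s + L * u) (at u)" for u
    by (auto intro!: derivative_eq_intros)
  show ?thesis
    using increment_le_of_DERIV_le[OF assms(4) DERIV_along_line[OF smooth] bound slope] by simp
qed

lemma cubic_upper_bound:
  assumes "x \<in> F" "x + d \<in> F" "norm d \<le> 1" "0 \<le> t" "t \<le> 1"
  shows "f (x + t *\<^sub>R d) \<le>
    f x + t * (grad f x \<bullet> d) + t\<^sup>2 / 2 * (d \<bullet> (hess f x *v d)) + \<rho> * t ^ 3 / 6"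
proof -
  define q where "q = d \<bullet> (hess f x *v d)"
  have curv: "d \<bullet> (hess f (x + v *\<^sub>R d) *v d) \<le> q + \<rho> * v" if "0 \<le> v" "v \<le> 1" for v
  proof -
    have "d \<bullet> (hess f (x + v *\<^sub>R d) *v d) - q = d \<bullet> ((hess f (x + v *\<^sub>R d) - hess f x) *v d)"
      by (simp add: q_def matrix_vector_mult_diff_rdistrib inner_diff_right)
    also have "\<dots> \<le> spectral_norm (hess f (x + v *\<^sub>R d) - hess f x)"
      using quadratic_form_le_spectral_norm[OF assms(3)] abs_le_D1 by blast
    also have "\<dots> \<le> \<rho> * norm (v *\<^sub>R d)"
      using hess_lipschitz[OF segment_in[OF assms(1,2)] assms(1), of v] that
      by (simp add: dist_norm)
    also have "\<dots> \<le> \<rho> * v"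
      using \<rho>_nonneg that assms(3) by (simp add: mult_left_le mult_left_mono)
    finally show ?thesis by simp
  qed
  have slope: "grad f (x + u *\<^sub>R d) \<bullet> d \<le> grad f x \<bullet> d + u * q + \<rho> * u\<^sup>2 / 2"
    if "0 \<le> u" "u \<le> t" for u
  proof -
    have bound: "((\<lambda>v. v * q + \<rho> * v\<^sup>2 / 2) has_real_derivative q + \<rho> * v) (at v)" for v
      by (auto intro!: derivative_eq_intros)
    have "d \<bullet> (hess f (x + v *\<^sub>R d) *v d) \<le> q + \<rho> * v" if "0 \<le> v" "v \<le> u" for v
      using curv that \<open>u \<le> t\<close> assms(5) by simp
    from increment_le_of_DERIV_le[OF that(1) DERIV_slope_along_line[OF smooth] bound this]
    show ?thesis by simp
  qed
  have bound: "((\<lambda>u. u * (grad f x \<bullet> d) + u\<^sup>2 / 2 * q + \<rho> * u ^ 3 / 6) has_real_derivative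
      grad f x \<bullet> d + u * q + \<rho> * u\<^sup>2 / 2) (at u)" for u
    by (auto intro!: derivative_eq_intros)
  show ?thesis
    using increment_le_of_DERIV_le[OF assms(4) DERIV_along_line[OF smooth] bound slope]
    by (simp add: q_def)
qed

text \<open>The step size \<open>chi f F x / Lt\<close> minimizes the quadratic upper bound with \<open>Lt\<close> in place of \<open>L\<close>;
  \<open>norm (grad f x) \<le> Lt\<close> makes it at most \<open>1\<close>, so that the step stays in \<open>F\<close>.\<close>
lemma first_order_decrease:
  assumes "x \<in> F" and s: "is_arg_min (\<lambda>s. grad f x \<bullet> s) (\<lambda>s. s \<in> dirs1 F x) s"
    and Lt: "L \<le> Lt" "norm (grad f x) \<le> Lt" "0 < Lt"
  shows "x + (chi f F x / Lt) *\<^sub>R s \<in> F"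
    and "f (x + (chi f F x / Lt) *\<^sub>R s) \<le> f x - (chi f F x)\<^sup>2 / (2 * Lt)"
proof -
  define c where "c = chi f F x"
  have s': "x + s \<in> F" "norm s \<le> 1"
    using s by (auto simp: is_arg_min_linorder dirs1_def)
  have c: "0 \<le> c" "c \<le> Lt" "grad f x \<bullet> s = - c"
    unfolding c_def using chi_nonneg[OF assms(1) s] chi_le_norm_grad[OF s] chi_eq[OF s] Lt by auto
  then have t: "0 \<le> c / Lt" "c / Lt \<le> 1"
    using Lt by auto
  show "x + (chi f F x / Lt) *\<^sub>R s \<in> F"
    using segment_in[OF assms(1) s'(1) t] by (simp add: c_def)
  have "f (x + (c / Lt) *\<^sub>R s) \<le> f x - c / Lt * c + L * (c / Lt)\<^sup>2 / 2"
    using quadratic_upper_bound[OF assms(1) s' t] c by simp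
  also have "\<dots> \<le> f x - c / Lt * c + Lt * (c / Lt)\<^sup>2 / 2"
    using Lt(1) by (simp add: divide_right_mono mult_right_mono)
  also have "\<dots> = f x - c\<^sup>2 / (2 * Lt)"
    using Lt(3) by (simp add: field_simps power2_eq_square)
  finally show "f (x + (chi f F x / Lt) *\<^sub>R s) \<le> f x - (chi f F x)\<^sup>2 / (2 * Lt)"
    by (simp add: c_def)
qed

text \<open>With \<open>p = psi f F x \<alpha>\<close> and \<open>t = 2 * p / \<rho>t\<close>, the three terms of the cubic upper bound are at
  most \<open>1/3\<close>, \<open>- 2\<close> and \<open>4/3\<close> times \<open>p ^ 3 / \<rho>t\<^sup>2\<close>, which leaves the required decrease of \<open>1/3\<close>.\<close>
lemma second_order_test_holds:
  assumes "x \<in> F" "0 \<le> \<alpha>"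
    and d: "is_arg_min (\<lambda>d. d \<bullet> (hess f x *v d)) (\<lambda>d. d \<in> dirs2 f F x \<alpha>) d"
    and \<rho>t: "\<rho> \<le> \<rho>t" "2 * spectral_norm (hess f x) \<le> \<rho>t" "0 < \<rho>t"
    and \<alpha>: "\<alpha> \<le> (psi f F x \<alpha>)\<^sup>2 / (6 * \<rho>t)"
  shows "second_order_test f F \<rho>t x \<alpha> d"
proof -
  define p where "p = psi f F x \<alpha>"
  have d': "x + d \<in> F" "norm d \<le> 1" "grad f x \<bullet> d \<le> p\<^sup>2 / (6 * \<rho>t)"
    using d \<alpha> by (auto simp: is_arg_min_linorder dirs2_def p_def)
  have p: "0 \<le> p" "2 * p \<le> \<rho>t" "d \<bullet> (hess f x *v d) = - p"
    unfolding p_def using psi_nonneg[OF closed assms(1,2), of f]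
      psi_le_spectral_norm[OF closed assms(1,2), of f] psi_eq[OF d] \<rho>t by auto
  define t where "t = 2 * p / \<rho>t"
  have t: "0 \<le> t" "t \<le> 1"
    using p \<rho>t(3) by (auto simp: t_def)
  have "f (x + t *\<^sub>R d) \<le> f x + t * (grad f x \<bullet> d) + t\<^sup>2 / 2 * (- p) + \<rho> * t ^ 3 / 6"
    using cubic_upper_bound[OF assms(1) d'(1,2) t] p(3) by simp
  also have "\<dots> \<le> f x + t * (p\<^sup>2 / (6 * \<rho>t)) + t\<^sup>2 / 2 * (- p) + \<rho>t * t ^ 3 / 6"
    using d'(3) t \<rho>t(1)
    by (intro add_mono mult_left_mono mult_right_mono divide_right_mono order_refl) auto
  also have "\<dots> = f x - p ^ 3 / (3 * \<rho>t\<^sup>2)"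
    using \<rho>t(3) by (simp add: t_def field_simps power2_eq_square power3_eq_cube)
  finally show ?thesis
    using p(2) d'(3) unfolding second_order_test_def t_def p_def by simp
qed

section \<open>One iteration\<close>

text \<open>Both branches achieve the larger of the two decreases that the first-order test compares.  The
  loop only ever lowers \<open>\<alpha>\<close> to positive values, so \<open>psi f F x 0\<close> is a lower bound for the value that
  the loop stops with.\<close>
lemma step_decrease:
  assumes "x \<in> F"
    and s: "is_arg_min (\<lambda>s. grad f x \<bullet> s) (\<lambda>s. s \<in> dirs1 F x) (s x)"
    and d: "\<And>\<alpha>. 0 < \<alpha> \<Longrightarrow>
      is_arg_min (\<lambda>d. d \<bullet> (hess f x *v d)) (\<lambda>d. d \<in> dirs2 f F x \<alpha>) (d x \<alpha>)"
    and Lt: "L \<le> Lt" "norm (grad f x) \<le> Lt" "0 < Lt"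
    and \<rho>t: "0 < \<rho>t"
    and "1 < \<gamma>" "0 < \<alpha>0"
    and step: "sofw_step f F Lt \<rho>t \<gamma> \<alpha>0 s d x = Some y"
  shows "y \<in> F" and "f y \<le> f x - (chi f F x)\<^sup>2 / (2 * Lt)"
    and "f y \<le> f x - psi f F x 0 ^ 3 / (3 * \<rho>t\<^sup>2)"
proof -
  define again where "again = (\<lambda>\<alpha>. \<not> first_order_test f F Lt \<rho>t x \<alpha> \<and>
    \<not> second_order_test f F \<rho>t x \<alpha> (d x \<alpha>))"
  obtain \<alpha> where loop: "while_option again (\<lambda>\<alpha>. \<alpha> / \<gamma>) \<alpha>0 = Some \<alpha>"
    and y: "y = (if first_order_test f F Lt \<rho>t x \<alpha> then x + (chi f F x / Lt) *\<^sub>R s x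
      else x + (2 * psi f F x \<alpha> / \<rho>t) *\<^sub>R d x \<alpha>)"
    using step unfolding sofw_step_def again_def by (auto split: if_splits option.splits)
  have "0 < \<alpha>"
    using while_option_rule[of "\<lambda>\<alpha>. 0 < \<alpha>", OF _ loop] assms(8,9) by simp
  have stop: "first_order_test f F Lt \<rho>t x \<alpha> \<or> second_order_test f F \<rho>t x \<alpha> (d x \<alpha>)"
    using while_option_stop[OF loop] by (simp add: again_def)
  have psi: "0 \<le> psi f F x 0" "psi f F x 0 \<le> psi f F x \<alpha>"
    using psi_nonneg[OF closed assms(1)] psi_mono[OF closed assms(1)] \<open>0 < \<alpha>\<close> by auto
  then have psi3: "psi f F x 0 ^ 3 / (3 * \<rho>t\<^sup>2) \<le> psi f F x \<alpha> ^ 3 / (3 * \<rho>t\<^sup>2)"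
    by (intro divide_right_mono power_mono) auto
  have "y \<in> F \<and> f y \<le> f x - (chi f F x)\<^sup>2 / (2 * Lt) \<and> f y \<le> f x - psi f F x \<alpha> ^ 3 / (3 * \<rho>t\<^sup>2)"
  proof (cases "first_order_test f F Lt \<rho>t x \<alpha>")
    case True
    then show ?thesis
      using first_order_decrease[OF assms(1) s Lt] y unfolding first_order_test_def by auto
  next
    case False
    with stop have t: "second_order_test f F \<rho>t x \<alpha> (d x \<alpha>)" by simp
    have "x + d x \<alpha> \<in> F"
      using d[OF \<open>0 < \<alpha>\<close>] by (simp add: is_arg_min_linorder dirs2_def)
    moreover have "0 \<le> 2 * psi f F x \<alpha> / \<rho>t" "2 * psi f F x \<alpha> / \<rho>t \<le> 1"
      using t psi \<rho>t by (auto simp: second_order_test_def)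
    ultimately have "y \<in> F"
      using False y segment_in[OF assms(1)] by simp
    then show ?thesis
      using t False y by (auto simp: second_order_test_def first_order_test_def)
  qed
  then show "y \<in> F" "f y \<le> f x - (chi f F x)\<^sup>2 / (2 * Lt)"
    "f y \<le> f x - psi f F x 0 ^ 3 / (3 * \<rho>t\<^sup>2)"
    using psi3 by auto
qed

text \<open>As long as the first-order test fails, \<open>psi f F x \<alpha>\<close> has a positive lower bound \<open>b\<close> that does
  not depend on \<open>\<alpha>\<close>; once \<open>\<alpha> \<le> b\<^sup>2 / (6 * \<rho>t)\<close>, the second-order test succeeds.  The
  algorithm does not terminate at \<open>x\<close> either, since it would do so only if \<open>chi f F x = 0\<close> and
  \<open>0 \<le> psi f F x 0 \<le> psi f F x \<alpha>0 = 0\<close>.\<close>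
lemma step_exists:
  assumes "x \<in> F"
    and s: "is_arg_min (\<lambda>s. grad f x \<bullet> s) (\<lambda>s. s \<in> dirs1 F x) (s x)"
    and d: "\<And>\<alpha>. 0 < \<alpha> \<Longrightarrow>
      is_arg_min (\<lambda>d. d \<bullet> (hess f x *v d)) (\<lambda>d. d \<in> dirs2 f F x \<alpha>) (d x \<alpha>)"
    and Lt: "0 < Lt"
    and \<rho>t: "\<rho> \<le> \<rho>t" "2 * spectral_norm (hess f x) \<le> \<rho>t" "0 < \<rho>t"
    and "1 < \<gamma>" "0 < \<alpha>0"
    and nonstationary: "chi f F x \<noteq> 0 \<or> psi f F x 0 \<noteq> 0"
  shows "\<exists>y. sofw_step f F Lt \<rho>t \<gamma> \<alpha>0 s d x = Some y"
proof -
  define again where "again = (\<lambda>\<alpha>. \<not> first_order_test f F Lt \<rho>t x \<alpha> \<and>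
    \<not> second_order_test f F \<rho>t x \<alpha> (d x \<alpha>))"
  have psi0: "0 \<le> psi f F x 0"
    using psi_nonneg[OF closed assms(1)] by simp
  obtain b where b: "0 < b"
    "\<And>\<alpha>. 0 < \<alpha> \<Longrightarrow> \<not> first_order_test f F Lt \<rho>t x \<alpha> \<Longrightarrow> b \<le> psi f F x \<alpha>"
  proof (cases "chi f F x = 0")
    case True
    then have "0 < psi f F x 0"
      using nonstationary psi0 by simp
    then show thesis
      using that[of "psi f F x 0"] psi_mono[OF closed assms(1)] by simp
  next
    case False
    define c where "c = 3 * \<rho>t\<^sup>2 * ((chi f F x)\<^sup>2 / (2 * Lt))"
    have "0 < c"
      using False Lt \<rho>t(3) by (simp add: c_def)
    have "root 3 c \<le> psi f F x \<alpha>" if "0 < \<alpha>" "\<not> first_order_test f F Lt \<rho>t x \<alpha>" for \<alpha>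
    proof -
      have "c \<le> psi f F x \<alpha> ^ 3"
        using that(2) \<rho>t(3) unfolding first_order_test_def c_def by (simp add: field_simps)
      then have "root 3 c \<le> root 3 (psi f F x \<alpha> ^ 3)"
        by simp
      also have "\<dots> = psi f F x \<alpha>"
        using psi_nonneg[OF closed assms(1)] that(1) by (simp add: real_root_power_cancel)
      finally show ?thesis .
    qed
    then show thesis
      using that[of "root 3 c"] \<open>0 < c\<close> by simp
  qed
  have "\<exists>k. \<not> again (((\<lambda>\<alpha>. \<alpha> / \<gamma>) ^^ k) \<alpha>0)"
  proof -
    have iter: "((\<lambda>\<alpha>. \<alpha> / \<gamma>) ^^ k) \<alpha>0 = \<alpha>0 / \<gamma> ^ k" for k
      by (induction k) (simp_all add: field_simps)
    define \<epsilon> where "\<epsilon> = b\<^sup>2 / (6 * \<rho>t)"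
    have "0 < \<epsilon>"
      using b(1) \<rho>t(3) by (simp add: \<epsilon>_def)
    obtain k where "\<alpha>0 / \<epsilon> < \<gamma> ^ k"
      using real_arch_pow[OF \<open>1 < \<gamma>\<close>] by blast
    then have small: "\<alpha>0 / \<gamma> ^ k \<le> \<epsilon>"
      using \<open>0 < \<epsilon>\<close> \<open>1 < \<gamma>\<close> by (simp add: field_simps)
    have pos: "0 < \<alpha>0 / \<gamma> ^ k"
      using \<open>1 < \<gamma>\<close> \<open>0 < \<alpha>0\<close> by simp
    have "second_order_test f F \<rho>t x (\<alpha>0 / \<gamma> ^ k) (d x (\<alpha>0 / \<gamma> ^ k))"
      if "\<not> first_order_test f F Lt \<rho>t x (\<alpha>0 / \<gamma> ^ k)"
    proof (rule second_order_test_holds[OF assms(1) less_imp_le[OF pos] d[OF pos] \<rho>t])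
      have "\<epsilon> \<le> (psi f F x (\<alpha>0 / \<gamma> ^ k))\<^sup>2 / (6 * \<rho>t)"
        unfolding \<epsilon>_def using b(1) b(2)[OF pos that] \<rho>t(3)
        by (intro divide_right_mono power_mono) auto
      with small show "\<alpha>0 / \<gamma> ^ k \<le> (psi f F x (\<alpha>0 / \<gamma> ^ k))\<^sup>2 / (6 * \<rho>t)"
        by (rule order_trans)
    qed
    then show ?thesis
      unfolding iter again_def by blast
  qed
  then obtain \<alpha> where "while_option again (\<lambda>\<alpha>. \<alpha> / \<gamma>) \<alpha>0 = Some \<alpha>"
    unfolding while_option_def by auto
  moreover have "\<not> (psi f F x \<alpha>0 = 0 \<and> chi f F x = 0)"
    using nonstationary psi0 psi_mono[OF closed assms(1), of 0 \<alpha>0 f] \<open>0 < \<alpha>0\<close> by auto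
  ultimately show ?thesis
    unfolding sofw_step_def again_def by auto
qed

end

section \<open>Counting iterations\<close>

lemma first_found_at_bound:
  fixes X :: "nat \<Rightarrow> (real ^ 'n) option" and f :: "real ^ 'n \<Rightarrow> real"
  assumes init: "X 0 = Some x0"
    and bounded: "\<And>k x. X k = Some x \<Longrightarrow> fmin \<le> f x"
    and decrease: "\<And>k x. X k = Some x \<Longrightarrow> \<not> P x \<Longrightarrow> \<exists>y. X (Suc k) = Some y \<and> f y \<le> f x - \<delta>"
    and "0 < \<delta>"
  shows "\<exists>k. first_found_at X P k \<and> real k * \<delta> \<le> f x0 - fmin"
proof -
  let ?found = "\<lambda>k. \<exists>x. X k = Some x \<and> P x"
  have progress: "\<exists>x. X k = Some x \<and> f x \<le> f x0 - real k * \<delta>" if "\<forall>j<k. \<not> ?found j" for k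
    using that
  proof (induction k)
    case 0
    then show ?case using init by simp
  next
    case (Suc k)
    then obtain x where x: "X k = Some x" "f x \<le> f x0 - real k * \<delta>"
      by auto
    then obtain y where "X (Suc k) = Some y" "f y \<le> f x - \<delta>"
      using decrease Suc.prems by blast
    then show ?case
      using x(2) by (auto simp: algebra_simps)
  qed
  have bound: "real k * \<delta> \<le> f x0 - fmin" if none: "\<forall>j<k. \<not> ?found j" for k
  proof -
    obtain x where "X k = Some x" "f x \<le> f x0 - real k * \<delta>"
      using progress[OF none] by blast
    then show ?thesis
      using bounded[of k x] by simp
  qed
  have "\<exists>k. ?found k"
  proof (rule ccontr)
    assume none: "\<not> (\<exists>k. ?found k)"
    obtain k where "f x0 - fmin < real k * \<delta>"
      using reals_Archimedean3[OF \<open>0 < \<delta>\<close>] by blast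
    then show False
      using bound[of k] none by auto
  qed
  then obtain k where "?found k" "\<forall>j<k. \<not> ?found j"
    using exists_least_iff[of ?found] by blast
  then show ?thesis
    using bound unfolding first_found_at_def by blast
qed

text \<open>The factors of \<open>real k\<close> are the decreases that every iteration from a non-stationary iterate
  achieves.  For second-order stationarity either tolerance may be the one that is exceeded, so only
  the smaller of the two decreases is certain.\<close>
lemma iteration_bounds:
  fixes f :: "real ^ 'n \<Rightarrow> real"
  assumes "1 < \<gamma>" "0 < \<alpha>0"
    and X: "X = sofw_iterate f F Lt \<rho>t \<gamma> \<alpha>0 S D x0"
    and Lt: "Lt = max L gmax" and \<rho>t: "\<rho>t = max \<rho> (2 * Hmax)"
    and "x0 \<in> F"
    and choice: "minimizer_choice f F S D"
    and A: "assumption_A f F fmin L \<rho> gmax Hmax X"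
  shows "0 < \<epsilon>g \<Longrightarrow> \<exists>k. first_found_at X (first_order_stationary f F \<epsilon>g) k \<and>
      real k * (\<epsilon>g\<^sup>2 / (2 * Lt)) \<le> f x0 - fmin"
    and "0 < \<epsilon>g \<Longrightarrow> 0 < \<epsilon>H \<Longrightarrow> \<exists>k. first_found_at X (second_order_stationary f F \<epsilon>g \<epsilon>H) k \<and>
      real k * min (\<epsilon>g\<^sup>2 / (2 * Lt)) (\<epsilon>H ^ 3 / (3 * \<rho>t\<^sup>2)) \<le> f x0 - fmin"
proof -
  interpret smooth_on_convex f F L \<rho>
    using A by unfold_locales (auto simp: assumption_A_def)
  have pos: "L \<le> Lt" "0 < Lt" "\<rho> \<le> \<rho>t" "0 < \<rho>t"
    using A by (auto simp: Lt \<rho>t assumption_A_def)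
  have arg_min: "is_arg_min (\<lambda>s. grad f x \<bullet> s) (\<lambda>s. s \<in> dirs1 F x) (S k x)"
    "\<And>\<alpha>. 0 < \<alpha> \<Longrightarrow>
      is_arg_min (\<lambda>d. d \<bullet> (hess f x *v d)) (\<lambda>d. d \<in> dirs2 f F x \<alpha>) (D k x \<alpha>)"
    if "x \<in> F" for k x
    using choice that unfolding minimizer_choice_def by auto
  have bounds: "norm (grad f x) \<le> Lt" "2 * spectral_norm (hess f x) \<le> \<rho>t"
    if "X k = Some x" for k x
    using A that unfolding assumption_A_def Lt \<rho>t by (fastforce simp: le_max_iff_disj)+
  have init: "X 0 = Some x0" and X_Suc: "X (Suc k) = Option.bind (X k)
      (sofw_step f F Lt \<rho>t \<gamma> \<alpha>0 (S k) (D k))" for k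
    by (simp_all add: X)
  have step: "y \<in> F" "f y \<le> f x - (chi f F x)\<^sup>2 / (2 * Lt)"
    "f y \<le> f x - psi f F x 0 ^ 3 / (3 * \<rho>t\<^sup>2)"
    if x: "x \<in> F" and k: "X k = Some x"
      and y: "sofw_step f F Lt \<rho>t \<gamma> \<alpha>0 (S k) (D k) x = Some y" for x y k
    using step_decrease[of x "S k" "D k", OF x arg_min[OF x] pos(1) bounds(1)[OF k] pos(2,4) assms(1,2) y]
    by blast+
  have in_F: "x \<in> F" if "X k = Some x" for k x
    using that
  proof (induction k arbitrary: x)
    case 0
    then show ?case using init \<open>x0 \<in> F\<close> by simp
  next
    case (Suc k)
    then obtain z where z: "X k = Some z" "sofw_step f F Lt \<rho>t \<gamma> \<alpha>0 (S k) (D k) z = Some x"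
      by (auto simp: X_Suc bind_eq_Some_conv)
    then show ?case
      using step(1) Suc.IH[OF z(1)] z by blast
  qed
  have bounded: "fmin \<le> f x" if "X k = Some x" for k x
    using in_F[OF that] A by (simp add: assumption_A_def)
  have next_iterate: "\<exists>y. X (Suc k) = Some y \<and> f y \<le> f x - (chi f F x)\<^sup>2 / (2 * Lt) \<and>
      f y \<le> f x - psi f F x 0 ^ 3 / (3 * \<rho>t\<^sup>2)"
    if k: "X k = Some x" and nonstationary: "chi f F x \<noteq> 0 \<or> psi f F x 0 \<noteq> 0" for k x
  proof -
    note x = in_F[OF k]
    obtain y where y: "sofw_step f F Lt \<rho>t \<gamma> \<alpha>0 (S k) (D k) x = Some y"
      using step_exists[of x "S k" "D k", OF x arg_min[OF x] pos(2,3) bounds(2)[OF k] pos(4) assms(1,2)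
          nonstationary] by blast
    then show ?thesis
      using step(2,3)[OF x k y] k X_Suc y by auto
  qed
  have chi_large: "\<epsilon>g\<^sup>2 / (2 * Lt) \<le> (chi f F x)\<^sup>2 / (2 * Lt)"
    if "0 < \<epsilon>g" "\<epsilon>g < chi f F x" for \<epsilon>g x
    using that pos(2) by (intro divide_right_mono power_mono) auto
  show "\<exists>k. first_found_at X (first_order_stationary f F \<epsilon>g) k \<and>
      real k * (\<epsilon>g\<^sup>2 / (2 * Lt)) \<le> f x0 - fmin" if "0 < \<epsilon>g"
  proof (rule first_found_at_bound[where f = f and X = X, OF init bounded])
    fix k x
    assume k: "X k = Some x" and "\<not> first_order_stationary f F \<epsilon>g x"
    then have "\<epsilon>g < chi f F x"
      using in_F[OF k] by (simp add: first_order_stationary_def)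
    then show "\<exists>y. X (Suc k) = Some y \<and> f y \<le> f x - \<epsilon>g\<^sup>2 / (2 * Lt)"
      using next_iterate[OF k] chi_large[OF that, of x] that by fastforce
  qed (use that pos in auto)
  show "\<exists>k. first_found_at X (second_order_stationary f F \<epsilon>g \<epsilon>H) k \<and>
      real k * min (\<epsilon>g\<^sup>2 / (2 * Lt)) (\<epsilon>H ^ 3 / (3 * \<rho>t\<^sup>2)) \<le> f x0 - fmin"
    if "0 < \<epsilon>g" "0 < \<epsilon>H"
  proof (rule first_found_at_bound[where f = f and X = X, OF init bounded])
    fix k x
    assume k: "X k = Some x" and "\<not> second_order_stationary f F \<epsilon>g \<epsilon>H x"
    then consider "\<epsilon>g < chi f F x" | "\<epsilon>H < psi f F x 0"
      using in_F[OF k] by (auto simp: second_order_stationary_def)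
    then show "\<exists>y. X (Suc k) = Some y \<and>
        f y \<le> f x - min (\<epsilon>g\<^sup>2 / (2 * Lt)) (\<epsilon>H ^ 3 / (3 * \<rho>t\<^sup>2))"
    proof cases
      case 1
      then show ?thesis
        using next_iterate[OF k] chi_large[OF that(1), of x] that by fastforce
    next
      case 2
      then have "\<epsilon>H ^ 3 / (3 * \<rho>t\<^sup>2) \<le> psi f F x 0 ^ 3 / (3 * \<rho>t\<^sup>2)"
        using that by (intro divide_right_mono power_mono) auto
      with 2 show ?thesis
        using next_iterate[OF k] that by fastforce
    qed
  qed (use that pos in auto)
qed

theorem theorem5p6:
  fixes L \<rho> gmax Hmax \<beta> \<gamma> \<alpha>0 \<Delta> :: real
  assumes "\<gamma> > 1" and "0 < \<alpha>0" and "\<alpha>0 \<le> 1"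
  shows "\<exists>C1 C2 :: real. \<forall>(f :: real ^ 'n \<Rightarrow> real) F fmin x0 S D X.
    X = sofw_iterate f F (max L gmax) (max \<rho> (2 * Hmax)) \<gamma> \<alpha>0 S D x0 \<longrightarrow>
    x0 \<in> F \<longrightarrow> f x0 - fmin = \<Delta> \<longrightarrow>
    minimizer_choice f F S D \<longrightarrow>
    assumption_A f F fmin L \<rho> gmax Hmax X \<longrightarrow>
    assumption_B f F \<beta> \<longrightarrow>
      (\<forall>\<epsilon>g>0. \<exists>k. first_found_at X (first_order_stationary f F \<epsilon>g) k \<and>
          real k \<le> C1 * (1 / \<epsilon>g\<^sup>2)) \<and>
      (\<forall>\<epsilon>g>0. \<forall>\<epsilon>H>0. \<exists>k. first_found_at X (second_order_stationary f F \<epsilon>g \<epsilon>H) k \<and>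
          real k \<le> C2 * max (1 / \<epsilon>g\<^sup>2) (1 / \<epsilon>H ^ 3))"
proof -
  define Lt where "Lt = max L gmax"
  define \<rho>t where "\<rho>t = max \<rho> (2 * Hmax)"
  define M where "M = max (2 * Lt) (3 * \<rho>t\<^sup>2)"
  show ?thesis
  proof (rule exI[of _ "2 * Lt * \<Delta>"], rule exI[of _ "M * \<Delta>"],
      intro allI impI conjI)
    fix f :: "real ^ 'n \<Rightarrow> real" and F fmin x0 S D X and \<epsilon>g :: real
    assume X: "X = sofw_iterate f F (max L gmax) (max \<rho> (2 * Hmax)) \<gamma> \<alpha>0 S D x0"
      and x0: "x0 \<in> F" "f x0 - fmin = \<Delta>"
      and choice: "minimizer_choice f F S D"
      and A: "assumption_A f F fmin L \<rho> gmax Hmax X"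
      and \<epsilon>g: "0 < \<epsilon>g"
    have pos: "0 < Lt" "0 < \<rho>t"
      using A by (auto simp: Lt_def \<rho>t_def assumption_A_def)
    note found = iteration_bounds[OF assms(1,2) X[folded Lt_def \<rho>t_def] Lt_def \<rho>t_def x0(1)
        choice A, unfolded x0(2)]
    show "\<exists>k. first_found_at X (first_order_stationary f F \<epsilon>g) k \<and>
        real k \<le> 2 * Lt * \<Delta> * (1 / \<epsilon>g\<^sup>2)"
      using found(1)[OF \<epsilon>g] \<epsilon>g pos by (auto simp: field_simps)
    fix \<epsilon>H :: real
    assume \<epsilon>H: "0 < \<epsilon>H"
    define m where "m = min (\<epsilon>g\<^sup>2 / (2 * Lt)) (\<epsilon>H ^ 3 / (3 * \<rho>t\<^sup>2))"
    define r where "r = max (1 / \<epsilon>g\<^sup>2) (1 / \<epsilon>H ^ 3)"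
    obtain k where k: "first_found_at X (second_order_stationary f F \<epsilon>g \<epsilon>H) k" "real k * m \<le> \<Delta>"
      using found(2)[OF \<epsilon>g \<epsilon>H] unfolding m_def by blast
    have "0 < m" "0 < r" "0 < M"
      using \<epsilon>g \<epsilon>H pos by (auto simp: m_def r_def M_def less_max_iff_disj)
    \<comment> \<open>The reciprocal of a minimum is a maximum, and \<open>M\<close> collects the constants of both entries.\<close>
    have "1 \<le> m * (M * r)"
    proof -
      have "1 = \<epsilon>g\<^sup>2 / (2 * Lt) * (2 * Lt * (1 / \<epsilon>g\<^sup>2))"
        using \<epsilon>g pos by simp
      also have "\<dots> \<le> \<epsilon>g\<^sup>2 / (2 * Lt) * (M * r)"
        using \<epsilon>g pos \<open>0 < M\<close> unfolding M_def r_def by (intro mult_left_mono mult_mono) auto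
      finally have 1: "1 \<le> \<epsilon>g\<^sup>2 / (2 * Lt) * (M * r)" .
      have "1 = \<epsilon>H ^ 3 / (3 * \<rho>t\<^sup>2) * (3 * \<rho>t\<^sup>2 * (1 / \<epsilon>H ^ 3))"
        using \<epsilon>H pos by simp
      also have "\<dots> \<le> \<epsilon>H ^ 3 / (3 * \<rho>t\<^sup>2) * (M * r)"
        using \<epsilon>H pos \<open>0 < M\<close> unfolding M_def r_def by (intro mult_left_mono mult_mono) auto
      finally show ?thesis
        using 1 by (simp add: m_def min_def)
    qed
    then have "real k \<le> real k * (m * (M * r))"
      by (simp add: mult_le_cancel_left1)
    also have "\<dots> \<le> \<Delta> * (M * r)"
      using k(2) \<open>0 < M\<close> \<open>0 < r\<close> by (simp add: mult.assoc[symmetric] mult_right_mono)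
    finally show "\<exists>k. first_found_at X (second_order_stationary f F \<epsilon>g \<epsilon>H) k \<and>
        real k \<le> M * \<Delta> * max (1 / \<epsilon>g\<^sup>2) (1 / \<epsilon>H ^ 3)"
      using k(1) by (auto simp: r_def mult_ac)
  qed
qed

end
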